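(* Let $X$ be a real Banach space, $A_n \in \mathscr{L}(X)$ for $n \in \{1,2,\ldots\}$, and for each $n\ge 0$ let $I_n^-, I_n^+ : X \to [0,\infty)$ be continuous homogeneous (not necessarily linear) functionals. Assume that there exist $c_1>0$, $c_2>0$, $K\in\{0,1,2,\ldots\}$, $\alpha_{k,n}^-\in X^*$ for $(k,n)\in\{1,\ldots,K\}\times\{0,1,\ldots\}$, $c_3,c_4>0$ and $0<a<b<\infty$ such that: \begin{enumerate} \item $c_1\|v\|_X \le I_n^-(v)+I_n^+(v)\le \frac{1}{c_1}\|v\|_X$ for all $n\ge0$, $v\in X$; \item $c_2\max_{1\le k\le K}|\langle \alpha_{k,n}^-,v\rangle| \le I_n^-(v)\le \frac{1}{c_2}\max_{1\le k\le K}|\langle \alpha_{k,n}^-,v\rangle|$ for all $n\ge0$, $v\in X$; \item $\mathcal{V}_{\mathrm s}(c_3,n)$ contains a linear space of dimension $K$ for all $n\ge0$; \item $c_4>3(c_1c_2)^{-2}(c_3+1)$; \item $I_n^-(v_n)\le a\,I_{n-1}^-(A_nv_n)$ for all $n\ge1$ and $v_n\in\mathcal{V}_{\mathrm s}(c_4,n)$; \item $I_n^+(v_n)\ge b\,I_{n-1}^+(A_nv_n)$ for all $n\ge1$ and $v_n\in X$ such that $A_nv_n\in\mathcal{V}_{\mathrm u}(c_3,n-1)$. \end{enumerate} Then the backward system $v_{n-1}=A_nv_n$ has an exponential dichotomy with values $a$ and $b$. For all $n\ge0$ the stable subspace $X_{\mathrm s}(n)$ is contained in $\mathcal{V}_{\mathrm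 s}(c_3,n)$ and has dimension $K$.
   Context: $\mathscr{L}(X)$ denotes bounded linear operators on $X$. Homogeneous means $I(\lambda v)=|\lambda| I(v)$ for $\lambda\in\mathbb{R}$. A maximum over an empty index set is $0$. The sequence $(A_n)$ need not be bounded and $A_n$ need not be invertible. Cones: for $c>0$, $\mathcal{V}_{\mathrm s}(c,n):=\{v\in X: I_n^+(v)\le c I_n^-(v)\}$ and $\mathcal{V}_{\mathrm u}(c,n):=\{v\in X: I_n^+(v)\ge c I_n^-(v)\}$. For $n\le m$: $A(n,n):=\mathrm{Id}$, $A(n,m):=A_{n+1}A_{n+2}\cdots A_m$. Exponential dichotomy (backward case): the system $v_{n-1}=A_nv_n$ has an exponential dichotomy with values $a$ and $b$, $0<a<b$, if for all $n\ge0$ there is a direct sum decomposition $X=X_{\mathrm s}(n)\oplus X_{\mathrm u}(n)$ with associated projections $\pi_{\mathrm s}(n)$, $\pi_{\mathrm u}(n)$ onto $X_{\mathrm s}(n)$, $X_{\mathrm u}(n)$, and a constant $C$, such that for all $n\le m$: (1) $A(n,m)\circ\pi_{\mathrm s}(m)=\pi_{\mathrm s}(n)\circ A(n,m)$ and $A(n,m)\circ\pi_{\mathrm u}(m)=\pi_{\mathrm u}(n)\circ A(n,m)$; (2) $\|\pi_{\mathrm s}(n)\|_{\mathscr{L}(X)}+\|\pi_{\mathrm u}(n)\|_{\mathscr{L}(X)}\le C$; (3) $A(n,m)|_{X_{\mathrm s}(m)}:X_{\mathrm s}(m)\to X_{\mathrm s}(n)$ is invertible; (4) $\|A(n,m)^{-1}v_n\|\le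 Ca^{m-n}\|v_n\|$ for all $v_n\in X_{\mathrm s}(n)$, where $A(n,m)^{-1}$ is the inverse of the restriction in (3); (5) $\|A(n,m)v_m\|\le Cb^{n-m}\|v_m\|$ for all $v_m\in X_{\mathrm u}(m)$. $X_{\mathrm s}(n)$ is called the stable subspace. *)

theory Defs
  imports "HOL-Analysis.Analysis"
begin

definition homogeneous :: "('a::real_vector \<Rightarrow> real) \<Rightarrow> bool" where
  "homogeneous f \<longleftrightarrow> (\<forall>r v. f (r *\<^sub>R v) = \<bar>r\<bar> * f v)"

text \<open>\<^const>\<open>Max\<close> is unspecified on the empty set; here the empty maximum is 0.\<close>

definition max_or_zero :: "real set \<Rightarrow> real" where
  "max_or_zero S = (if S = {} then 0 else Max S)"

text \<open>\<^const>\<open>dim\<close> returns 0 on infinite-dimensional subspaces, so \<open>dim S = k\<close> would not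
  express "finite-dimensional of dimension k" when \<open>k = 0\<close>. The basis is therefore explicit.\<close>

definition subspace_of_dim :: "'a::real_vector set \<Rightarrow> nat \<Rightarrow> bool" where
  "subspace_of_dim S k \<longleftrightarrow>
     subspace S \<and> (\<exists>B. finite B \<and> independent B \<and> span B = S \<and> card B = k)"

definition stable_cone ::
    "(nat \<Rightarrow> 'a \<Rightarrow> real) \<Rightarrow> (nat \<Rightarrow> 'a \<Rightarrow> real) \<Rightarrow> real \<Rightarrow> nat \<Rightarrow> 'a set" where
  "stable_cone Iminus Iplus c n = {v. Iplus n v \<le> c * Iminus n v}"

definition unstable_cone ::
    "(nat \<Rightarrow> 'a \<Rightarrow> real) \<Rightarrow> (nat \<Rightarrow> 'a \<Rightarrow> real) \<Rightarrow> real \<Rightarrow> nat \<Rightarrow> 'a set" where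
  "unstable_cone Iminus Iplus c n = {v. Iplus n v \<ge> c * Iminus n v}"

text \<open>For \<open>n \<le> m\<close> this is \<open>A (n+1) \<circ> A (n+2) \<circ> \<dots> \<circ> A m\<close>, mapping time \<open>m\<close> to time \<open>n\<close>;
  it is the identity for \<open>n = m\<close>. The value \<open>A 0\<close> is never used.\<close>

definition evol ::
    "(nat \<Rightarrow> 'a::real_normed_vector \<Rightarrow>\<^sub>L 'a) \<Rightarrow> nat \<Rightarrow> nat \<Rightarrow> 'a \<Rightarrow>\<^sub>L 'a" where
  "evol A n m = foldr (o\<^sub>L) (map A [Suc n..<Suc m]) id_blinfun"

definition direct_sum_decomposition :: "'a::real_vector set \<Rightarrow> 'a set \<Rightarrow> bool" where
  "direct_sum_decomposition S U \<longleftrightarrow>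
     subspace S \<and> subspace U \<and> S \<inter> U = {0} \<and> (\<forall>v. \<exists>x\<in>S. \<exists>y\<in>U. v = x + y)"

definition associated_projections ::
    "'a::real_normed_vector set \<Rightarrow> 'a set \<Rightarrow> ('a \<Rightarrow>\<^sub>L 'a) \<Rightarrow> ('a \<Rightarrow>\<^sub>L 'a) \<Rightarrow> bool" where
  "associated_projections S U P Q \<longleftrightarrow>
     (\<forall>v. blinfun_apply P v \<in> S \<and> blinfun_apply Q v \<in> U
        \<and> v = blinfun_apply P v + blinfun_apply Q v)"

text \<open>Exponential dichotomy of the backward system \<open>v (n-1) = A n (v n)\<close> with values \<open>a\<close>, \<open>b\<close>,
  stable subspaces \<open>Xs n\<close> and unstable subspaces \<open>Xu n\<close>. The constant \<open>C\<close> is uniform in time.\<close>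

definition exponential_dichotomy ::
    "(nat \<Rightarrow> 'a::real_normed_vector \<Rightarrow>\<^sub>L 'a) \<Rightarrow> real \<Rightarrow> real \<Rightarrow>
     (nat \<Rightarrow> 'a set) \<Rightarrow> (nat \<Rightarrow> 'a set) \<Rightarrow> bool" where
  "exponential_dichotomy A a b Xs Xu \<longleftrightarrow>
     0 < a \<and> a < b \<and>
     (\<exists>(Ps :: nat \<Rightarrow> 'a \<Rightarrow>\<^sub>L 'a) (Pu :: nat \<Rightarrow> 'a \<Rightarrow>\<^sub>L 'a) (C :: real).
        (\<forall>n. direct_sum_decomposition (Xs n) (Xu n)
           \<and> associated_projections (Xs n) (Xu n) (Ps n) (Pu n)
           \<and> norm (Ps n) + norm (Pu n) \<le> C) \<and>
        (\<forall>n m. n \<le> m \<longrightarrow>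
             evol A n m o\<^sub>L Ps m = Ps n o\<^sub>L evol A n m
           \<and> evol A n m o\<^sub>L Pu m = Pu n o\<^sub>L evol A n m
           \<and> bij_betw (blinfun_apply (evol A n m)) (Xs m) (Xs n)
           \<and> (\<forall>v\<in>Xs n. norm (inv_into (Xs m) (blinfun_apply (evol A n m)) v)
                          \<le> C * a ^ (m - n) * norm v)
           \<and> (\<forall>v\<in>Xu m. norm (blinfun_apply (evol A n m) v)
                          \<le> C * b powi (int n - int m) * norm v)))"

end

theory Submission
  imports Defs
begin

text \<open>
  Running the system from time \<open>m\<close> back to an earlier time \<open>n\<close> preserves the stable cones with
  constants \<open>c\<^sub>3\<close> and \<open>c\<^sub>4\<close>: on them \<open>Iminus\<close> grows at least by \<open>1/a\<close> per step, whereas a vector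
  that left the cone would have had its \<open>Iplus\<close> shrunk by \<open>1/b < 1/a\<close> (\<open>stable_cone_step\<close>). In
  particular the evolution is injective on these cones.

  There is freedom in the unstable space at time \<open>0\<close>; the unstable space \<open>Xu n\<close> at time \<open>n\<close>
  then has to be its preimage under the evolution. Taking the common kernel of the \<open>K\<close>
  functionals \<open>\<alpha> k 0\<close>, a vector of \<open>Xu n\<close> in a stable cone would be mapped to a stable vector
  with \<open>Iminus 0 = 0\<close>, so it vanishes. Hence \<open>Xu n\<close> consists of unstable vectors, along which
  the evolution contracts at rate \<open>1/b\<close>, and, having codimension at most \<open>K\<close>, it is a complement
  of every \<open>K\<close>-dimensional space in the stable cone (\<open>stable_complement\<close>). The quantitative gap
  between \<open>c\<^sub>3\<close> and \<open>c\<^sub>4\<close> makes all the resulting projections uniformly bounded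
  (\<open>stable_part_bound\<close>).

  The stable space is a limit from the far future. A \<open>K\<close>-dimensional space in the stable cone at
  time \<open>m\<close> is transported back to time \<open>n\<close> and yields a projection along \<open>Xu n\<close>. For two such
  projections of the same vector the difference lies in \<open>Xu n\<close>, so it has been contracted by a
  factor of order \<open>1 / b ^ (m - n)\<close> on its way from time \<open>m\<close>, while the two stable vectors it is
  the difference of have been expanded by at least the order \<open>1 / a ^ (m - n)\<close>. The difference
  is therefore of relative size \<open>(a / b) ^ (m - n)\<close> (\<open>approx_proj_diff\<close>), and the projections
  converge pointwise. All properties required of the limit pass through the convergence, because
  the cones and \<open>Xu n\<close> are closed and the evolution intertwines the approximating projections
  exactly (\<open>approx_proj_evol\<close>).
\<close>

section \<open>Linear algebra\<close>

text \<open>Gaussian elimination: a basis vector on which the functional \<open>f k\<close> does not vanish is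
  subtracted, suitably scaled, from the other ones, which costs one basis vector and moves the
  others into the kernel of \<open>f k\<close>.\<close>

lemma common_kernel_meets_span:
  fixes f :: "'i \<Rightarrow> 'a::real_vector \<Rightarrow> real"
  assumes "finite F" "\<And>k. k \<in> F \<Longrightarrow> linear (f k)"
    and "finite B" "independent B" "card F < card B"
  shows "\<exists>w\<in>span B. w \<noteq> 0 \<and> (\<forall>k\<in>F. f k w = 0)"
  using assms
proof (induction F arbitrary: B rule: finite_induct)
  case empty
  then obtain x where "x \<in> B" by fastforce
  moreover have "x \<noteq> 0" using empty \<open>x \<in> B\<close> dependent_zero by blast
  ultimately show ?case using span_base by blast
next
  case (insert k F)
  have lin: "linear (f k)" using insert.prems by simp
  show ?case
  proof (cases "\<forall>x\<in>B. f k x = 0")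
    case True
    then have "f k w = 0" if "w \<in> span B" for w
      using linear_eq_0_on_span[OF lin] that by blast
    moreover have "\<exists>w\<in>span B. w \<noteq> 0 \<and> (\<forall>k\<in>F. f k w = 0)"
      using insert.prems insert.hyps by (intro insert.IH) auto
    ultimately show ?thesis by blast
  next
    case False
    then obtain x where x: "x \<in> B" "f k x \<noteq> 0" by blast
    \<comment> \<open>the projection onto the kernel of \<open>f k\<close> along \<open>x\<close>\<close>
    define g where "g = (\<lambda>y. y - (f k y / f k x) *\<^sub>R x)"
    have lg: "linear g"
      unfolding g_def
      by (rule linearI)
        (simp_all add: linear_add[OF lin] linear_scale[OF lin] algebra_simps add_divide_distrib)
    have ker: "y = 0" if y: "y \<in> span (B - {x})" and "g y = 0" for y
    proof (rule ccontr)
      assume "y \<noteq> 0"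
      have eq: "y = (f k y / f k x) *\<^sub>R x" using that by (simp add: g_def)
      then have "f k y \<noteq> 0" using \<open>y \<noteq> 0\<close> by auto
      then have "f k x / f k y * (f k y / f k x) = 1" using x(2) by simp
      then have "(f k x / f k y) *\<^sub>R y = x"
        using arg_cong[OF eq, of "\<lambda>z. (f k x / f k y) *\<^sub>R z"] by (metis scaleR_one scaleR_scaleR)
      then have "x \<in> span (B - {x})" using span_scale[OF y, of "f k x / f k y"] by simp
      then show False using insert.prems x dependent_def by blast
    qed
    have inj: "inj_on g (span (B - {x}))"
    proof (rule inj_onI)
      fix y z assume "y \<in> span (B - {x})" "z \<in> span (B - {x})" "g y = g z"
      then have "y - z = 0" by (intro ker[of "y - z"]) (auto intro: span_diff simp: linear_diff[OF lg])
      then show "y = z" by simp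
    qed
    have ind: "independent (g ` (B - {x}))"
      by (rule linear_independent_injective_image[OF lg _ inj])
        (meson Diff_subset independent_mono insert.prems)
    have "card (g ` (B - {x})) = card B - 1"
      using inj x insert.prems by (subst card_image) (auto intro: inj_on_subset[OF _ span_superset])
    then have "\<exists>w\<in>span (g ` (B - {x})). w \<noteq> 0 \<and> (\<forall>k\<in>F. f k w = 0)"
      using insert.prems insert.hyps ind by (intro insert.IH) auto
    then obtain w where w: "w \<in> span (g ` (B - {x}))" "w \<noteq> 0" "\<forall>k\<in>F. f k w = 0" by blast
    have "f k y = 0" if "y \<in> g ` (B - {x})" for y
      using that x(2) by (auto simp: g_def linear_diff[OF lin] linear_scale[OF lin])
    then have "f k w = 0" using linear_eq_0_on_span[OF lin] w by blast
    moreover have "g ` (B - {x}) \<subseteq> span B"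
      using x by (auto simp: g_def intro!: span_diff span_scale intro: span_base)
    then have "w \<in> span B" using w span_minimal by blast
    ultimately show ?thesis using w by blast
  qed
qed

text \<open>For \<open>v\<close> outside \<open>S\<close>, the span of \<open>S\<close> and \<open>v\<close> contains \<open>K + 1\<close> independent vectors and so
  meets nontrivially the common kernel of \<open>K\<close> functionals; the coefficient of \<open>v\<close> in a nonzero
  vector found there is nonzero, and solving for \<open>v\<close> gives its decomposition.\<close>

lemma complement_of_common_kernel:
  fixes f :: "nat \<Rightarrow> 'a::real_vector \<Rightarrow> real"
  assumes S: "subspace_of_dim S K" and lin: "\<And>k. k \<in> {1..K} \<Longrightarrow> linear (f k)"
    and trivial: "\<And>w. w \<in> S \<Longrightarrow> \<forall>k\<in>{1..K}. f k w = 0 \<Longrightarrow> w = 0"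
  shows "direct_sum_decomposition S {v. \<forall>k\<in>{1..K}. f k v = 0}"
proof -
  obtain B where B: "finite B" "independent B" "span B = S" "card B = K"
    using S by (auto simp: subspace_of_dim_def)
  have subS: "subspace S" using S by (simp add: subspace_of_dim_def)
  have subU: "subspace {v. \<forall>k\<in>{1..K}. f k v = 0}"
    by (auto simp: subspace_def linear_add[OF lin] linear_scale[OF lin] linear_0[OF lin])
  have ex: "\<exists>x\<in>S. \<forall>k\<in>{1..K}. f k (v - x) = 0" for v
  proof (cases "v \<in> S")
    case True
    then show ?thesis using linear_0[OF lin] by (intro bexI[of _ v]) auto
  next
    case False
    then have "independent (insert v B)" "v \<notin> B"
      using B by (auto simp: independent_insert span_base)
    then obtain w where w: "w \<in> span (insert v B)" "w \<noteq> 0" "\<forall>k\<in>{1..K}. f k w = 0"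
      using common_kernel_meets_span[of "{1..K}" f "insert v B"] B lin by auto
    then obtain c where c: "w - c *\<^sub>R v \<in> S" using B by (auto simp: span_insert)
    have "c \<noteq> 0" using c w trivial[of w] by auto
    have "v - (- (1 / c)) *\<^sub>R (w - c *\<^sub>R v) = (1 / c) *\<^sub>R w"
      using \<open>c \<noteq> 0\<close> by (simp add: algebra_simps)
    then have "\<forall>k\<in>{1..K}. f k (v - (- (1 / c)) *\<^sub>R (w - c *\<^sub>R v)) = 0"
      using w linear_scale[OF lin] by simp
    moreover have "(- (1 / c)) *\<^sub>R (w - c *\<^sub>R v) \<in> S" using c subS subspace_scale by blast
    ultimately show ?thesis by blast
  qed
  have "\<exists>x\<in>S. \<exists>y\<in>{v. \<forall>k\<in>{1..K}. f k v = 0}. v = x + y" for v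
  proof -
    obtain x where "x \<in> S" "\<forall>k\<in>{1..K}. f k (v - x) = 0" using ex by blast
    then show ?thesis by (intro bexI[of _ x] bexI[of _ "v - x"]) auto
  qed
  moreover have "S \<inter> {v. \<forall>k\<in>{1..K}. f k v = 0} = {0}"
    using trivial subspace_0[OF subS] subspace_0[OF subU] by blast
  ultimately show ?thesis using subS subU by (simp add: direct_sum_decomposition_def)
qed

lemma subspace_of_dim_image:
  assumes "subspace_of_dim S k" "linear f" "\<And>x. x \<in> S \<Longrightarrow> f x = 0 \<Longrightarrow> x = 0"
  shows "subspace_of_dim (f ` S) k"
proof -
  obtain B where B: "finite B" "independent B" "span B = S" "card B = k"
    using assms(1) by (auto simp: subspace_of_dim_def)
  have sub: "subspace S" using assms(1) by (simp add: subspace_of_dim_def)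
  have inj: "inj_on f S"
  proof (rule inj_onI)
    fix x y assume "x \<in> S" "y \<in> S" "f x = f y"
    then have "x - y = 0"
      by (intro assms(3)[of "x - y"] subspace_diff[OF sub]) (auto simp: linear_diff[OF assms(2)])
    then show "x = y" by simp
  qed
  then have "inj_on f B" using B inj_on_subset span_superset by blast
  then have "card (f ` B) = k" using B card_image by blast
  moreover have "independent (f ` B)"
    using linear_independent_injective_image[OF assms(2) B(2)] inj B by simp
  moreover have "span (f ` B) = f ` S" using linear_span_image[OF assms(2)] B by simp
  ultimately show ?thesis unfolding subspace_of_dim_def
    using B linear_subspace_image[OF assms(2) sub] by blast
qed

definition oblique_projection :: "'a::real_vector set \<Rightarrow> 'a set \<Rightarrow> 'a \<Rightarrow> 'a" where
  "oblique_projection S U v = (THE w. w \<in> S \<and> v - w \<in> U)"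

lemma oblique_projection_eqI:
  assumes "direct_sum_decomposition S U" "w \<in> S" "v - w \<in> U"
  shows "oblique_projection S U v = w"
  unfolding oblique_projection_def
proof (rule the_equality)
  have sub: "subspace S" "subspace U"
    using assms(1) by (auto simp: direct_sum_decomposition_def)
  fix w' assume w': "w' \<in> S \<and> v - w' \<in> U"
  have "w' - w \<in> S"
    using subspace_diff[OF sub(1), of w' w] w' assms(2) by blast
  moreover have "(v - w) - (v - w') \<in> U"
    using subspace_diff[OF sub(2), of "v - w" "v - w'"] w' assms(3) by blast
  ultimately have "w' - w \<in> S \<inter> U" by simp
  moreover have "S \<inter> U = {0}" using assms(1) by (simp add: direct_sum_decomposition_def)
  ultimately have "w' - w = 0" by blast
  then show "w' = w" by simp
qed (use assms in simp)

lemma oblique_projection: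
  assumes "direct_sum_decomposition S U"
  shows "oblique_projection S U v \<in> S" "v - oblique_projection S U v \<in> U"
proof -
  obtain x y where xy: "x \<in> S" "y \<in> U" "v = x + y"
    using assms unfolding direct_sum_decomposition_def by blast
  then have "oblique_projection S U v = x" by (intro oblique_projection_eqI[OF assms]) auto
  then show "oblique_projection S U v \<in> S" "v - oblique_projection S U v \<in> U" using xy by auto
qed

lemma oblique_projection_linear:
  assumes "direct_sum_decomposition S U"
  shows "linear (oblique_projection S U)"
proof (rule linearI)
  have sub: "subspace S" "subspace U" using assms by (auto simp: direct_sum_decomposition_def)
  note p = oblique_projection[OF assms]
  fix x y and r :: real
  have "(x - oblique_projection S U x) + (y - oblique_projection S U y) \<in> U"
    using p subspace_add[OF sub(2)] by blast
  then show "oblique_projection S U (x + y) = oblique_projection S U x + oblique_projection S U y"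
    by (intro oblique_projection_eqI[OF assms] subspace_add[OF sub(1)] p) (simp add: algebra_simps)
  have "r *\<^sub>R (x - oblique_projection S U x) \<in> U"
    using p subspace_scale[OF sub(2)] by blast
  then show "oblique_projection S U (r *\<^sub>R x) = r *\<^sub>R oblique_projection S U x"
    by (intro oblique_projection_eqI[OF assms] subspace_scale[OF sub(1)] p)
      (simp add: algebra_simps)
qed

section \<open>The evolution family\<close>

lemma evol_refl [simp]: "evol A n n = id_blinfun"
  by (simp add: evol_def)

lemma evol_Suc:
  assumes "n \<le> m"
  shows "blinfun_apply (evol A n (Suc m)) v = blinfun_apply (evol A n m) (blinfun_apply (A (Suc m)) v)"
proof -
  have fold: "foldr (o\<^sub>L) xs B = foldr (o\<^sub>L) xs id_blinfun o\<^sub>L B"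
    for xs and B :: "'a \<Rightarrow>\<^sub>L 'a"
    by (induction xs) (auto intro!: blinfun_eqI)
  have "evol A n (Suc m) = foldr (o\<^sub>L) (map A [Suc n..<Suc m]) (A (Suc m) o\<^sub>L id_blinfun)"
    using assms by (simp add: evol_def)
  then show ?thesis by (subst (asm) fold) (simp add: evol_def)
qed

lemma evol_evol:
  assumes "n \<le> m" "m \<le> l"
  shows "blinfun_apply (evol A n m) (blinfun_apply (evol A m l) v) = blinfun_apply (evol A n l) v"
  using assms(2)
proof (induction l arbitrary: v rule: dec_induct)
  case (step l)
  then show ?case using assms by (simp add: evol_Suc)
qed simp

lemma evol_evol_image:
  "n \<le> m \<Longrightarrow> m \<le> l \<Longrightarrow> blinfun_apply (evol A n m) ` blinfun_apply (evol A m l) ` S = blinfun_apply (evol A n l) ` S"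
  by (simp add: image_image evol_evol)

section \<open>Invariant cones\<close>

locale cone_system =
  fixes A :: "nat \<Rightarrow> 'a::banach \<Rightarrow>\<^sub>L 'a"
    and Iminus Iplus :: "nat \<Rightarrow> 'a \<Rightarrow> real"
    and c\<^sub>1 c\<^sub>2 c\<^sub>3 c\<^sub>4 a b :: real
    and K :: nat
    and \<alpha> :: "nat \<Rightarrow> nat \<Rightarrow> 'a \<Rightarrow>\<^sub>L real"
  assumes Iminus_nonneg: "Iminus n v \<ge> 0" and Iplus_nonneg: "Iplus n v \<ge> 0"
    and Iminus_cont: "continuous_on UNIV (Iminus n)" and Iplus_cont: "continuous_on UNIV (Iplus n)"
    and Iminus_hom: "homogeneous (Iminus n)" and Iplus_hom: "homogeneous (Iplus n)"
    and c1: "c\<^sub>1 > 0" and c2: "c\<^sub>2 > 0" and c3: "c\<^sub>3 > 0" and c4: "c\<^sub>4 > 0" and a: "0 < a" and ab: "a < b"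
    and norm_le: "c\<^sub>1 * norm v \<le> Iminus n v + Iplus n v"
    and le_norm: "Iminus n v + Iplus n v \<le> 1 / c\<^sub>1 * norm v"
    and coord_le: "c\<^sub>2 * max_or_zero ((\<lambda>k. \<bar>blinfun_apply (\<alpha> k n) v\<bar>) ` {1..K}) \<le> Iminus n v"
    and le_coord: "Iminus n v \<le> 1 / c\<^sub>2 * max_or_zero ((\<lambda>k. \<bar>blinfun_apply (\<alpha> k n) v\<bar>) ` {1..K})"
    and cone_dim: "\<exists>S. subspace_of_dim S K \<and> S \<subseteq> stable_cone Iminus Iplus c\<^sub>3 n"
    and c4_gt: "c\<^sub>4 > 3 * (c\<^sub>1 * c\<^sub>2) powi (-2) * (c\<^sub>3 + 1)"
    and Iminus_step: "n \<ge> 1 \<Longrightarrow> v \<in> stable_cone Iminus Iplus c\<^sub>4 n \<Longrightarrow>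
           Iminus n v \<le> a * Iminus (n - 1) (blinfun_apply (A n) v)"
    and Iplus_step: "n \<ge> 1 \<Longrightarrow> blinfun_apply (A n) v \<in> unstable_cone Iminus Iplus c\<^sub>3 (n - 1) \<Longrightarrow>
           Iplus n v \<ge> b * Iplus (n - 1) (blinfun_apply (A n) v)"
begin

abbreviation Vs where "Vs \<equiv> stable_cone Iminus Iplus"
abbreviation Vu where "Vu \<equiv> unstable_cone Iminus Iplus"
abbreviation coord_max where
  "coord_max n v \<equiv> max_or_zero ((\<lambda>k. \<bar>blinfun_apply (\<alpha> k n) v\<bar>) ` {1..K})"

lemma b: "b > 0" using a ab by simp

text \<open>The constants that turn the growth rates of \<open>Iminus\<close> on the stable cone and of \<open>Iplus\<close> on
  the unstable spaces into growth rates of the norm. They do not depend on time.\<close>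

definition "D\<^sub>s = (c\<^sub>3 + 1) / c\<^sub>1\<^sup>2"
definition "D\<^sub>u = (1 / c\<^sub>4 + 1) / c\<^sub>1\<^sup>2"

lemma D_nonneg: "0 \<le> D\<^sub>s" "0 \<le> D\<^sub>u"
  using c3 c4 by (simp_all add: D\<^sub>s_def D\<^sub>u_def)

lemma Iminus_0 [simp]: "Iminus n 0 = 0"
  using Iminus_hom[of n] unfolding homogeneous_def by (metis abs_zero mult_zero_left scaleR_zero_left)

lemma Iplus_0 [simp]: "Iplus n 0 = 0"
  using Iplus_hom[of n] unfolding homogeneous_def by (metis abs_zero mult_zero_left scaleR_zero_left)

lemma Iminus_le_norm: "Iminus n v \<le> norm v / c\<^sub>1"
  using le_norm[of n v] Iplus_nonneg[of n v] by simp

lemma Iplus_le_norm: "Iplus n v \<le> norm v / c\<^sub>1"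
  using le_norm[of n v] Iminus_nonneg[of n v] by simp

lemma norm_le_Iminus:
  assumes "v \<in> Vs c n"
  shows "norm v \<le> (c + 1) / c\<^sub>1 * Iminus n v"
proof -
  have "c\<^sub>1 * norm v \<le> (c + 1) * Iminus n v"
    using norm_le[of v n] assms by (simp add: stable_cone_def algebra_simps)
  then show ?thesis using c1 by (simp add: field_simps)
qed

lemma stable_cone_eq_0: "v \<in> Vs c n \<Longrightarrow> Iminus n v = 0 \<Longrightarrow> v = 0"
  using norm_le_Iminus[of v c n] by simp

lemma coord_max_le:
  assumes "\<And>k. k \<in> {1..K} \<Longrightarrow> \<bar>blinfun_apply (\<alpha> k n) v\<bar> \<le> r" "0 \<le> r"
  shows "coord_max n v \<le> r"
  using assms by (auto simp: max_or_zero_def)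

lemma coord_le_max:
  "k \<in> {1..K} \<Longrightarrow> \<bar>blinfun_apply (\<alpha> k n) v\<bar> \<le> coord_max n v"
  by (auto simp: max_or_zero_def)

lemma coord_max_nonneg: "0 \<le> coord_max n v"
proof (cases "K = 0")
  case False
  then show ?thesis using coord_le_max[of 1 n v] by simp
qed (simp add: max_or_zero_def)

lemma coord_max_triangle: "coord_max n v \<le> coord_max n (v + w) + coord_max n w"
proof (rule coord_max_le)
  fix k assume k: "k \<in> {1..K}"
  have "blinfun_apply (\<alpha> k n) v = blinfun_apply (\<alpha> k n) (v + w) - blinfun_apply (\<alpha> k n) w"
    by (simp add: blinfun.add_right)
  then show "\<bar>blinfun_apply (\<alpha> k n) v\<bar> \<le> coord_max n (v + w) + coord_max n w"
    using coord_le_max[OF k, of n "v + w"] coord_le_max[OF k, of n w] by linarith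
qed (use coord_max_nonneg in \<open>simp add: add_nonneg_nonneg\<close>)

lemma c4_bound: "3 * (c\<^sub>3 + 1) / (c\<^sub>1 * c\<^sub>2)\<^sup>2 < c\<^sub>4"
  using c4_gt by (simp add: power_int_minus field_simps)

text \<open>A nonzero vector of the cone has \<open>Iminus n v > 0\<close>, and then the two-sided estimates force
  \<open>c\<^sub>1 \<le> 1\<close> and \<open>c\<^sub>2 \<le> 1\<close>, so that the lower bound on \<open>c\<^sub>4\<close> gives \<open>c\<^sub>3 \<le> c\<^sub>4\<close>. If no such vector
  exists, the constants need not be ordered, but the cone for \<open>c\<^sub>3\<close> is \<open>{0}\<close>.\<close>

lemma stable_cone_c3_subset_c4: "Vs c\<^sub>3 n \<subseteq> Vs c\<^sub>4 n"
proof
  fix v assume v: "v \<in> Vs c\<^sub>3 n"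
  show "v \<in> Vs c\<^sub>4 n"
  proof (cases "v = 0")
    case False
    then have I: "Iminus n v > 0"
      using stable_cone_eq_0[OF v] Iminus_nonneg[of n v] by fastforce
    have "c\<^sub>1 * norm v \<le> 1 / c\<^sub>1 * norm v" using norm_le le_norm order_trans by blast
    then have "c\<^sub>1 * c\<^sub>1 \<le> 1" using False c1 by (simp add: field_simps)
    then have "c\<^sub>1 \<le> 1" using c1 less_1_mult[of c\<^sub>1 c\<^sub>1] by linarith
    have "coord_max n v > 0"
      using I le_coord[of n v] c2 coord_max_nonneg[of n v] by (cases "coord_max n v = 0") auto
    moreover have "c\<^sub>2 * coord_max n v \<le> 1 / c\<^sub>2 * coord_max n v"
      using coord_le le_coord order_trans by blast
    ultimately have "c\<^sub>2 * c\<^sub>2 \<le> 1" using c2 by (simp add: field_simps)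
    then have "c\<^sub>2 \<le> 1" using c2 less_1_mult[of c\<^sub>2 c\<^sub>2] by linarith
    have "(c\<^sub>1 * c\<^sub>2)\<^sup>2 \<le> 1"
      using \<open>c\<^sub>1 \<le> 1\<close> \<open>c\<^sub>2 \<le> 1\<close> c1 c2 by (simp add: mult_le_one power_le_one)
    then have "3 * (c\<^sub>3 + 1) \<le> 3 * (c\<^sub>3 + 1) / (c\<^sub>1 * c\<^sub>2)\<^sup>2"
      using c1 c2 c3 by (simp add: le_divide_eq mult_left_le)
    then have "c\<^sub>3 \<le> c\<^sub>4" using c4_bound c3 by simp
    then show ?thesis using v order_trans[OF _ mult_right_mono[of c\<^sub>3 c\<^sub>4 "Iminus n v"]] I
      by (simp add: stable_cone_def)
  qed (simp add: stable_cone_def)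
qed

lemma not_stable_imp_unstable: "v \<notin> Vs c n \<Longrightarrow> v \<in> Vu c n"
  by (simp add: stable_cone_def unstable_cone_def)

lemma stable_cone_step_if_image_unstable:
  assumes "0 \<le> c" "v \<in> Vs c (Suc n)" "v \<in> Vs c\<^sub>4 (Suc n)"
    and "blinfun_apply (A (Suc n)) v \<in> Vu c\<^sub>3 n"
  shows "blinfun_apply (A (Suc n)) v \<in> Vs c n"
proof -
  let ?w = "blinfun_apply (A (Suc n)) v"
  have "b * Iplus n ?w \<le> Iplus (Suc n) v" using Iplus_step[of "Suc n" v] assms by simp
  also have "\<dots> \<le> c * Iminus (Suc n) v" using assms by (simp add: stable_cone_def)
  also have "\<dots> \<le> c * (a * Iminus n ?w)"
    using Iminus_step[of "Suc n" v] assms by (intro mult_left_mono) auto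
  also have "\<dots> \<le> c * (b * Iminus n ?w)"
    using ab assms Iminus_nonneg by (intro mult_left_mono mult_right_mono) auto
  finally show ?thesis using b by (simp add: stable_cone_def algebra_simps)
qed

text \<open>An image outside the cone would lie in the unstable cone for \<open>c\<^sub>3\<close>, where the contraction
  of \<open>Iplus\<close> applies; together with the expansion of \<open>Iminus\<close> and \<open>a < b\<close> this puts the image
  back into the cone.\<close>

lemma stable_cone_step:
  assumes "v \<in> Vs c (Suc n)" "c = c\<^sub>3 \<or> c = c\<^sub>4"
  shows "blinfun_apply (A (Suc n)) v \<in> Vs c n"
proof (rule ccontr)
  assume *: "blinfun_apply (A (Suc n)) v \<notin> Vs c n"
  then have "blinfun_apply (A (Suc n)) v \<in> Vu c\<^sub>3 n"
    using assms(2) stable_cone_c3_subset_c4 not_stable_imp_unstable by blast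
  then show False
    using stable_cone_step_if_image_unstable[of c v n] assms * c3 c4 stable_cone_c3_subset_c4[of "Suc n"] by auto
qed

lemma stable_cone_evol:
  assumes "n \<le> m" "v \<in> Vs c m" "c = c\<^sub>3 \<or> c = c\<^sub>4"
  shows "blinfun_apply (evol A n m) v \<in> Vs c n"
  using assms(1,2)
proof (induction m arbitrary: v rule: dec_induct)
  case (step m)
  then show ?case using stable_cone_step assms(3) by (simp add: evol_Suc)
qed simp

lemma Iminus_evol:
  assumes "n \<le> m" "v \<in> Vs c\<^sub>4 m"
  shows "Iminus m v \<le> a ^ (m - n) * Iminus n (blinfun_apply (evol A n m) v)"
  using assms
proof (induction m arbitrary: v rule: dec_induct)
  case (step m)
  let ?w = "blinfun_apply (A (Suc m)) v"
  have "Iminus (Suc m) v \<le> a * Iminus m ?w" using Iminus_step[of "Suc m" v] step by simp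
  also have "\<dots> \<le> a * (a ^ (m - n) * Iminus n (blinfun_apply (evol A n m) ?w))"
    using step stable_cone_step a by (intro mult_left_mono step.IH) auto
  finally show ?case using step by (simp add: evol_Suc Suc_diff_le mult.assoc)
qed simp

lemma evol_stable_cone_eq_0:
  assumes "n \<le> m" "v \<in> Vs c\<^sub>4 m" "Iminus n (blinfun_apply (evol A n m) v) = 0"
  shows "v = 0"
  using Iminus_evol[OF assms(1,2)] assms Iminus_nonneg[of m v]
  by (intro stable_cone_eq_0[OF assms(2)]) auto

lemma norm_le_evol:
  assumes "n \<le> m" "v \<in> Vs c\<^sub>3 m"
  shows "norm v \<le> D\<^sub>s * a ^ (m - n) * norm (blinfun_apply (evol A n m) v)"
proof -
  let ?w = "blinfun_apply (evol A n m) v"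
  have "norm v \<le> (c\<^sub>3 + 1) / c\<^sub>1 * Iminus m v" using assms norm_le_Iminus by blast
  also have "\<dots> \<le> (c\<^sub>3 + 1) / c\<^sub>1 * (a ^ (m - n) * (norm ?w / c\<^sub>1))"
  proof (rule mult_left_mono)
    have "Iminus m v \<le> a ^ (m - n) * Iminus n ?w"
      using assms stable_cone_c3_subset_c4 by (intro Iminus_evol) auto
    also have "\<dots> \<le> a ^ (m - n) * (norm ?w / c\<^sub>1)"
      using a Iminus_le_norm by (intro mult_left_mono) auto
    finally show "Iminus m v \<le> a ^ (m - n) * (norm ?w / c\<^sub>1)" .
  qed (use c1 c3 in simp)
  finally show ?thesis by (simp add: D\<^sub>s_def power2_eq_square)
qed

section \<open>The unstable spaces\<close>

text \<open>At time \<open>0\<close> the common kernel of the functionals is a convenient choice since \<open>Iminus 0\<close>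
  vanishes on it. Invariance then dictates the other times.\<close>

definition Xu :: "nat \<Rightarrow> 'a set" where
  "Xu n = {v. \<forall>k\<in>{1..K}. blinfun_apply (\<alpha> k 0) (blinfun_apply (evol A 0 n) v) = 0}"

lemma Xu_evol_iff:
  "n \<le> m \<Longrightarrow> blinfun_apply (evol A n m) v \<in> Xu n \<longleftrightarrow> v \<in> Xu m"
  by (simp add: Xu_def evol_evol)

lemma Xu_subspace: "subspace (Xu n)"
  by (auto simp: Xu_def subspace_def blinfun.add_right blinfun.scaleR_right)

lemma Xu_closed: "closed (Xu n)"
proof -
  have "Xu n = (\<Inter>k\<in>{1..K}. {v. blinfun_apply (\<alpha> k 0) (blinfun_apply (evol A 0 n) v) = 0})"
    by (auto simp: Xu_def)
  then show ?thesis by (auto intro!: closed_Collect_eq continuous_intros)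
qed

text \<open>Stable vectors have an \<open>Iminus\<close> that grows on the way back to time \<open>0\<close>, where it is zero
  for vectors coming from \<open>Xu n\<close>.\<close>

lemma Xu_stable_cone_trivial:
  assumes "v \<in> Xu n" "v \<in> Vs c n" "c = c\<^sub>3 \<or> c = c\<^sub>4"
  shows "v = 0"
proof (rule evol_stable_cone_eq_0[of 0 n])
  have "coord_max 0 (blinfun_apply (evol A 0 n) v) \<le> 0"
    using assms(1) by (intro coord_max_le) (auto simp: Xu_def)
  then show "Iminus 0 (blinfun_apply (evol A 0 n) v) = 0"
    using le_coord[of 0 "blinfun_apply (evol A 0 n) v"]
      coord_max_nonneg[of 0 "blinfun_apply (evol A 0 n) v"]
      Iminus_nonneg[of 0 "blinfun_apply (evol A 0 n) v"] by auto
qed (use assms stable_cone_c3_subset_c4 in auto)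

lemma Xu_subset_unstable_cone:
  assumes "v \<in> Xu n" "c = c\<^sub>3 \<or> c = c\<^sub>4"
  shows "v \<in> Vu c n"
proof (cases "v = 0")
  case False
  then show ?thesis using Xu_stable_cone_trivial assms not_stable_imp_unstable by blast
qed (simp add: unstable_cone_def)

lemma Iplus_evol:
  assumes "n \<le> m" "v \<in> Xu m"
  shows "b ^ (m - n) * Iplus n (blinfun_apply (evol A n m) v) \<le> Iplus m v"
  using assms
proof (induction m arbitrary: v rule: dec_induct)
  case (step m)
  let ?w = "blinfun_apply (A (Suc m)) v"
  have w: "?w \<in> Xu m" using Xu_evol_iff[of m "Suc m" v] step by (simp add: evol_Suc)
  have "b * (b ^ (m - n) * Iplus n (blinfun_apply (evol A n m) ?w)) \<le> b * Iplus m ?w"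
    using step.IH[OF w] b by simp
  also have "\<dots> \<le> Iplus (Suc m) v"
    using Iplus_step[of "Suc m" v] Xu_subset_unstable_cone[OF w] by simp
  finally show ?case using step by (simp add: evol_Suc Suc_diff_le mult.assoc)
qed simp

lemma evol_Xu_le_norm:
  assumes "n \<le> m" "v \<in> Xu m"
  shows "norm (blinfun_apply (evol A n m) v) \<le> D\<^sub>u * (1 / b) ^ (m - n) * norm v"
proof -
  let ?w = "blinfun_apply (evol A n m) v"
  have "?w \<in> Vu c\<^sub>4 n" using assms Xu_evol_iff Xu_subset_unstable_cone by blast
  then have "Iminus n ?w \<le> 1 / c\<^sub>4 * Iplus n ?w"
    using c4 by (simp add: unstable_cone_def field_simps)
  then have "c\<^sub>1 * norm ?w \<le> (1 / c\<^sub>4 + 1) * Iplus n ?w"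
    using norm_le[of ?w n] by (simp add: algebra_simps)
  also have "\<dots> \<le> (1 / c\<^sub>4 + 1) * ((1 / b) ^ (m - n) * (norm v / c\<^sub>1))"
  proof (rule mult_left_mono)
    have "b ^ (m - n) * Iplus n ?w \<le> norm v / c\<^sub>1"
      using Iplus_evol[OF assms] Iplus_le_norm[of m v] by linarith
    then show "Iplus n ?w \<le> (1 / b) ^ (m - n) * (norm v / c\<^sub>1)"
      using b c1 by (simp add: field_simps)
  qed (use c4 in simp)
  finally have *: "c\<^sub>1 * norm ?w \<le> (1 / c\<^sub>4 + 1) * ((1 / b) ^ (m - n) * (norm v / c\<^sub>1))" .
  have "norm ?w = (c\<^sub>1 * norm ?w) / c\<^sub>1" using c1 by simp
  also have "\<dots> \<le> (1 / c\<^sub>4 + 1) * ((1 / b) ^ (m - n) * (norm v / c\<^sub>1)) / c\<^sub>1"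
    using * c1 by (intro divide_right_mono) auto
  finally show ?thesis by (simp add: D\<^sub>u_def power2_eq_square)
qed

text \<open>The angle between the stable cone and \<open>Xu n\<close> is bounded below uniformly in time. Since
  \<open>Iminus\<close> need not be subadditive, the triangle inequality is applied to the comparable
  seminorm \<open>coord_max\<close>. The contribution of \<open>d\<close> to it is small because \<open>d\<close> lies in the unstable
  cone for the large constant \<open>c\<^sub>4\<close>, and the bound on \<open>c\<^sub>4\<close> is such that this contribution can
  be absorbed into the left-hand side.\<close>

lemma stable_part_bound:
  assumes "u \<in> Vs c\<^sub>3 n" "d \<in> Xu n"
  shows "norm u \<le> (c\<^sub>4 + 1) / 2 * norm (u + d)"
proof -
  define s where "s = norm (u + d)"
  have d: "norm d \<le> s + norm u"
    unfolding s_def using norm_triangle_ineq4[of "u + d" u] by simp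
  have q: "(c\<^sub>3 + 1) / (c\<^sub>1 * c\<^sub>2)\<^sup>2 \<le> c\<^sub>4 / 3"
    using c4_bound c1 c2 by (simp add: field_simps)
  have Nd: "c\<^sub>2 * coord_max n d \<le> (s + norm u) / (c\<^sub>1 * c\<^sub>4)"
  proof -
    have "c\<^sub>2 * coord_max n d \<le> Iminus n d" by (rule coord_le)
    also have "\<dots> \<le> Iplus n d / c\<^sub>4"
      using Xu_subset_unstable_cone[OF assms(2)] c4 by (simp add: unstable_cone_def field_simps)
    also have "\<dots> \<le> norm d / c\<^sub>1 / c\<^sub>4" using Iplus_le_norm c4 by (intro divide_right_mono) auto
    also have "\<dots> \<le> (s + norm u) / c\<^sub>1 / c\<^sub>4" using d c1 c4 by (intro divide_right_mono) auto
    finally show ?thesis by simp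
  qed
  have Ns: "c\<^sub>2 * coord_max n (u + d) \<le> s / c\<^sub>1"
    using coord_le[of n "u + d"] Iminus_le_norm[of n "u + d"] by (simp add: s_def)
  have "norm u \<le> (c\<^sub>3 + 1) / c\<^sub>1 * Iminus n u" using assms norm_le_Iminus by blast
  also have "\<dots> \<le> (c\<^sub>3 + 1) / c\<^sub>1 * (1 / c\<^sub>2 * (coord_max n (u + d) + coord_max n d))"
    using le_coord[of n u] coord_max_triangle[of n u d] c1 c2 c3
    by (intro mult_left_mono order_trans[OF le_coord]) auto
  also have "\<dots> = (c\<^sub>3 + 1) / (c\<^sub>1 * c\<^sub>2\<^sup>2) * (c\<^sub>2 * coord_max n (u + d) + c\<^sub>2 * coord_max n d)"
    using c2 by (simp add: power2_eq_square flip: distrib_left)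
  also have "\<dots> \<le> (c\<^sub>3 + 1) / (c\<^sub>1 * c\<^sub>2\<^sup>2) * (s / c\<^sub>1 + (s + norm u) / (c\<^sub>1 * c\<^sub>4))"
    using Nd Ns c1 c2 c3 by (intro mult_left_mono) auto
  also have "\<dots> = (c\<^sub>3 + 1) / (c\<^sub>1 * c\<^sub>2)\<^sup>2 * (s + (s + norm u) / c\<^sub>4)"
    using c1 c2 c4 by (simp add: field_simps power2_eq_square)
  also have "\<dots> \<le> c\<^sub>4 / 3 * (s + (s + norm u) / c\<^sub>4)"
    using q c4 by (intro mult_right_mono) (auto simp: s_def)
  also have "\<dots> = (c\<^sub>4 * s + s + norm u) / 3" using c4 by (simp add: field_simps)
  \<comment> \<open>the term \<open>norm u / 3\<close> on the right is absorbed here\<close>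
  finally show ?thesis by (simp add: s_def field_simps)
qed

lemma stable_complement:
  assumes "subspace_of_dim S K" "S \<subseteq> Vs c\<^sub>3 n"
  shows "direct_sum_decomposition S (Xu n)"
  unfolding Xu_def
proof (rule complement_of_common_kernel[OF assms(1)])
  show "linear (\<lambda>v. blinfun_apply (\<alpha> k 0) (blinfun_apply (evol A 0 n) v))" for k
    by (rule linearI) (simp_all add: blinfun.add_right blinfun.scaleR_right)
  show "w = 0"
    if "w \<in> S" "\<forall>k\<in>{1..K}. blinfun_apply (\<alpha> k 0) (blinfun_apply (evol A 0 n) w) = 0" for w
  proof (rule Xu_stable_cone_trivial)
    show "w \<in> Xu n" using that by (simp add: Xu_def)
    show "w \<in> Vs c\<^sub>3 n" using that assms by blast
  qed simp
qed

lemma evol_image_stable: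
  assumes "n \<le> m" "subspace_of_dim S K" "S \<subseteq> Vs c\<^sub>3 m"
  shows "subspace_of_dim (blinfun_apply (evol A n m) ` S) K"
    and "blinfun_apply (evol A n m) ` S \<subseteq> Vs c\<^sub>3 n"
proof -
  show "subspace_of_dim (blinfun_apply (evol A n m) ` S) K"
  proof (rule subspace_of_dim_image[OF assms(2)])
    show "x = 0" if "x \<in> S" "blinfun_apply (evol A n m) x = 0" for x
    proof (rule evol_stable_cone_eq_0[OF assms(1)])
      show "x \<in> Vs c\<^sub>4 m" using that assms(3) stable_cone_c3_subset_c4 by blast
    qed (simp add: that)
  qed (rule bounded_linear.linear[OF blinfun.bounded_linear_right])
  show "blinfun_apply (evol A n m) ` S \<subseteq> Vs c\<^sub>3 n"
    using stable_cone_evol[OF assms(1)] assms(3) by auto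
qed

section \<open>The stable spaces\<close>

definition seed :: "nat \<Rightarrow> 'a set" where
  "seed n = (SOME S. subspace_of_dim S K \<and> S \<subseteq> Vs c\<^sub>3 n)"

lemma seed: "subspace_of_dim (seed n) K" "seed n \<subseteq> Vs c\<^sub>3 n"
  using someI_ex[OF cone_dim[of n]] unfolding seed_def by auto

text \<open>The stable space at time \<open>n\<close> as seen from the horizon \<open>m\<close>: an arbitrary choice made at
  time \<open>m\<close> and transported back, whose arbitrariness is forgotten as \<open>m\<close> tends to infinity.\<close>

definition approx_stable :: "nat \<Rightarrow> nat \<Rightarrow> 'a set" where
  "approx_stable n m = blinfun_apply (evol A n m) ` seed m"

lemma approx_stable_cone: "n \<le> m \<Longrightarrow> approx_stable n m \<subseteq> Vs c\<^sub>3 n"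
  unfolding approx_stable_def 
  by (intro evol_image_stable(2) seed)

lemma approx_stable_complement:
  "n \<le> m \<Longrightarrow> direct_sum_decomposition (approx_stable n m) (Xu n)"
  unfolding approx_stable_def
  by (intro stable_complement evol_image_stable seed)

abbreviation approx_proj :: "nat \<Rightarrow> nat \<Rightarrow> 'a \<Rightarrow> 'a" where
  "approx_proj n m \<equiv> oblique_projection (approx_stable n m) (Xu n)"

lemma approx_proj_bound:
  assumes "n \<le> m"
  shows "norm (approx_proj n m v) \<le> (c\<^sub>4 + 1) / 2 * norm v"
  using stable_part_bound[of "approx_proj n m v" n "v - approx_proj n m v"]
    oblique_projection[OF approx_stable_complement[OF assms]] approx_stable_cone[OF assms] by auto

lemma approx_proj_evol:
  assumes "n \<le> m" "m \<le> l"
  shows "approx_proj n l (blinfun_apply (evol A n m) v) = blinfun_apply (evol A n m) (approx_proj m l v)"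
proof (rule oblique_projection_eqI)
  have "approx_proj m l v \<in> approx_stable m l"
    using oblique_projection(1)[OF approx_stable_complement[OF assms(2)]] .
  then show "blinfun_apply (evol A n m) (approx_proj m l v) \<in> approx_stable n l"
    unfolding approx_stable_def using evol_evol_image[OF assms] by blast
  have "v - approx_proj m l v \<in> Xu m"
    using oblique_projection(2)[OF approx_stable_complement[OF assms(2)]] .
  then show "blinfun_apply (evol A n m) v - blinfun_apply (evol A n m) (approx_proj m l v) \<in> Xu n"
    using Xu_evol_iff[OF assms(1)] by (simp flip: blinfun.diff_right)
qed (use approx_stable_complement assms in simp)

text \<open>The difference of the lifts at time \<open>m\<close> lies in \<open>Xu m\<close>, so it is contracted at rate \<open>1/b\<close>;
  each lift itself is shorter than its image by a factor of order \<open>a ^ (m - n)\<close>.\<close>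

lemma two_stable_lifts:
  assumes "n \<le> m" "u \<in> Vs c\<^sub>3 m" "u' \<in> Vs c\<^sub>3 m"
    and "blinfun_apply (evol A n m) u - blinfun_apply (evol A n m) u' \<in> Xu n"
  shows "norm (blinfun_apply (evol A n m) u - blinfun_apply (evol A n m) u')
    \<le> D\<^sub>u * D\<^sub>s * (a / b) ^ (m - n)
      * (norm (blinfun_apply (evol A n m) u) + norm (blinfun_apply (evol A n m) u'))"
proof -
  let ?w = "blinfun_apply (evol A n m) u" and ?w' = "blinfun_apply (evol A n m) u'"
  have factor: "p * x * (q * y * s + q * y * t) = p * q * (x * y) * (s + t)"
    for p q x y s t :: real by (simp add: algebra_simps)
  have d: "u - u' \<in> Xu m"
    using assms(4) Xu_evol_iff[OF assms(1)] by (simp flip: blinfun.diff_right)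
  have "norm (?w - ?w') \<le> D\<^sub>u * (1 / b) ^ (m - n) * norm (u - u')"
    using evol_Xu_le_norm[OF assms(1) d] by (simp add: blinfun.diff_right)
  also have "\<dots> \<le> D\<^sub>u * (1 / b) ^ (m - n) *
      (D\<^sub>s * a ^ (m - n) * norm ?w + D\<^sub>s * a ^ (m - n) * norm ?w')"
    using norm_triangle_ineq4[of u u'] norm_le_evol[OF assms(1,2)] norm_le_evol[OF assms(1,3)] D_nonneg b
    by (intro mult_left_mono) auto
  also have "\<dots> = D\<^sub>u * D\<^sub>s * ((1 / b) ^ (m - n) * a ^ (m - n))
      * (norm ?w + norm ?w')"
    by (rule factor)
  also have "(1 / b) ^ (m - n) * a ^ (m - n) = (a / b) ^ (m - n)"
    by (simp flip: power_mult_distrib)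
  finally show ?thesis .
qed

text \<open>The space seen from the later horizon \<open>l\<close> is also the image of a space in the stable cone
  at time \<open>m\<close>, so both projected vectors have stable lifts at the same time \<open>m\<close>.\<close>

lemma approx_proj_diff:
  assumes "n \<le> m" "m \<le> l"
  shows "norm (approx_proj n m v - approx_proj n l v)
    \<le> D\<^sub>u * D\<^sub>s * (a / b) ^ (m - n) * ((c\<^sub>4 + 1) * norm v)"
proof -
  let ?w = "approx_proj n m v" and ?w' = "approx_proj n l v"
  note p = oblique_projection[OF approx_stable_complement]
  have nl: "n \<le> l" using assms by simp
  obtain u where u: "u \<in> Vs c\<^sub>3 m" "?w = blinfun_apply (evol A n m) u"
    using p(1)[OF assms(1), of v] seed by (auto simp: approx_stable_def)
  have "?w' \<in> blinfun_apply (evol A n m) ` approx_stable m l"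
    using p(1)[OF nl, of v] evol_evol_image[OF assms, of A "seed l"]
    by (simp only: approx_stable_def)
  then obtain u' where u': "u' \<in> Vs c\<^sub>3 m" "?w' = blinfun_apply (evol A n m) u'"
    using approx_stable_cone[OF assms(2)] by blast
  have "(v - ?w') - (v - ?w) \<in> Xu n"
    by (intro subspace_diff[OF Xu_subspace] p(2) assms(1) nl)
  then have "?w - ?w' \<in> Xu n" by simp
  then have "norm (?w - ?w') \<le> D\<^sub>u * D\<^sub>s * (a / b) ^ (m - n)
      * (norm ?w + norm ?w')"
    using two_stable_lifts[OF assms(1) u(1) u'(1)] u u' by simp
  also have "\<dots> \<le> D\<^sub>u * D\<^sub>s * (a / b) ^ (m - n) * ((c\<^sub>4 + 1) * norm v)"
  proof (rule mult_left_mono)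
    show "norm ?w + norm ?w' \<le> (c\<^sub>4 + 1) * norm v"
      using approx_proj_bound[OF assms(1), of v] approx_proj_bound[OF nl, of v]
      by (simp add: field_simps)
    show "0 \<le> D\<^sub>u * D\<^sub>s * (a / b) ^ (m - n)"
      using D_nonneg a b by (intro mult_nonneg_nonneg) auto
  qed
  finally show ?thesis .
qed

text \<open>The sequence starts at the horizon \<open>n\<close>, since only horizons \<open>m \<ge> n\<close> give a projection.\<close>

definition proj :: "nat \<Rightarrow> 'a \<Rightarrow> 'a" where
  "proj n v = lim (\<lambda>j. approx_proj n (n + j) v)"

lemma approx_proj_tendsto: "(\<lambda>j. approx_proj n (n + j) v) \<longlonglongrightarrow> proj n v"
proof -
  define r where "r j = D\<^sub>u * D\<^sub>s * (a / b) ^ j * ((c\<^sub>4 + 1) * norm v)" for j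
  have "(\<lambda>j. (a / b) ^ j) \<longlonglongrightarrow> 0" using a ab by (intro LIMSEQ_power_zero) (simp add: field_simps)
  then have r0: "r \<longlonglongrightarrow> 0" unfolding r_def
    by (intro tendsto_mult_left_zero tendsto_mult_right_zero)
  have "Cauchy (\<lambda>j. approx_proj n (n + j) v)"
    unfolding Cauchy_altdef2
  proof (intro allI impI)
    fix e :: real assume "e > 0"
    then obtain N where "norm (r N) < e" using LIMSEQ_D[OF r0] by fastforce
    moreover have "dist (approx_proj n (n + j) v) (approx_proj n (n + N) v) \<le> r N" if "j \<ge> N" for j
      using approx_proj_diff[of n "n + N" "n + j" v] that by (simp add: r_def dist_norm norm_minus_commute)
    ultimately show "\<exists>N. \<forall>j\<ge>N. dist (approx_proj n (n + j) v) (approx_proj n (n + N) v) < e"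
      by (intro exI[of _ N]) fastforce
  qed
  then show ?thesis unfolding proj_def
    using Cauchy_convergent_iff convergent_LIMSEQ_iff by blast
qed

lemma proj_mem_cone: "proj n v \<in> Vs c\<^sub>3 n"
proof -
  have "closed (Vs c\<^sub>3 n)"
    unfolding stable_cone_def using Iminus_cont Iplus_cont
    by (intro closed_Collect_le continuous_intros)
  then show ?thesis
  proof (rule closed_sequentially[OF _ _ approx_proj_tendsto])
    show "approx_proj n (n + j) v \<in> Vs c\<^sub>3 n" for j
      using oblique_projection(1)[OF approx_stable_complement, of n "n + j" v] approx_stable_cone[of n "n + j"] by auto
  qed
qed

lemma diff_proj_mem_Xu: "v - proj n v \<in> Xu n"
proof (rule closed_sequentially[OF Xu_closed])
  show "(\<lambda>j. v - approx_proj n (n + j) v) \<longlonglongrightarrow> v - proj n v"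
    by (intro tendsto_intros approx_proj_tendsto)
  show "v - approx_proj n (n + j) v \<in> Xu n" for j
    using oblique_projection(2)[OF approx_stable_complement] by simp
qed

lemma proj_bound: "norm (proj n v) \<le> (c\<^sub>4 + 1) / 2 * norm v"
  using stable_part_bound[OF proj_mem_cone[of n v] diff_proj_mem_Xu[of v n]] by simp

lemma proj_bounded_linear: "bounded_linear (proj n)"
proof
  have lin: "linear (approx_proj n (n + j))" for j
    by (intro oblique_projection_linear approx_stable_complement) simp
  show "proj n (x + y) = proj n x + proj n y" for x y
    using LIMSEQ_unique[OF approx_proj_tendsto[of n "x + y"]]
      tendsto_add[OF approx_proj_tendsto[of n x] approx_proj_tendsto[of n y]]
    by (simp add: linear_add[OF lin])
  show "proj n (r *\<^sub>R x) = r *\<^sub>R proj n x" for r x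
    using LIMSEQ_unique[OF approx_proj_tendsto[of n "r *\<^sub>R x"]]
      tendsto_scaleR[OF tendsto_const[of r] approx_proj_tendsto[of n x]]
    by (simp add: linear_scale[OF lin])
  show "\<exists>C. \<forall>x. norm (proj n x) \<le> norm x * C"
    using proj_bound by (intro exI[of _ "(c\<^sub>4 + 1) / 2"]) (simp add: mult.commute)
qed

lemma proj_evol:
  assumes "n \<le> m"
  shows "proj n (blinfun_apply (evol A n m) v) = blinfun_apply (evol A n m) (proj m v)"
proof (rule LIMSEQ_unique)
  show "(\<lambda>j. approx_proj n (m + j) (blinfun_apply (evol A n m) v))
      \<longlonglongrightarrow> proj n (blinfun_apply (evol A n m) v)"
    using LIMSEQ_ignore_initial_segment[OF approx_proj_tendsto[of n "blinfun_apply (evol A n m) v"], of "m - n"] assms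
    by (simp add: add.commute add.left_commute)
  show "(\<lambda>j. approx_proj n (m + j) (blinfun_apply (evol A n m) v))
      \<longlonglongrightarrow> blinfun_apply (evol A n m) (proj m v)"
    using assms by (simp add: approx_proj_evol blinfun.tendsto tendsto_const approx_proj_tendsto)
qed

definition Xs :: "nat \<Rightarrow> 'a set" where
  "Xs n = range (proj n)"

lemma Xs_cone: "Xs n \<subseteq> Vs c\<^sub>3 n"
  using proj_mem_cone by (auto simp: Xs_def)

text \<open>The range of \<open>proj n\<close> is already attained on one \<open>K\<close>-dimensional space of the stable cone,
  because such a space is a complement of the kernel \<open>Xu n\<close>.\<close>

lemma Xs_dim: "subspace_of_dim (Xs n) K"
proof -
  have lin: "linear (proj n)" by (simp add: proj_bounded_linear bounded_linear.linear)
  have ker: "proj n v = 0 \<longleftrightarrow> v \<in> Xu n" for v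
  proof
    assume "v \<in> Xu n"
    then have "v - (v - proj n v) \<in> Xu n"
      by (intro subspace_diff[OF Xu_subspace] diff_proj_mem_Xu)
    then have "proj n v \<in> Xu n" by simp
    then show "proj n v = 0" using Xu_stable_cone_trivial proj_mem_cone by blast
  qed (use diff_proj_mem_Xu[of v n] in simp)
  have "Xs n = proj n ` seed n"
  proof
    show "Xs n \<subseteq> proj n ` seed n"
    proof
      fix x assume "x \<in> Xs n"
      then obtain v where v: "x = proj n v" by (auto simp: Xs_def)
      obtain w d where "w \<in> seed n" "d \<in> Xu n" "v = w + d"
        using stable_complement[OF seed] unfolding direct_sum_decomposition_def by metis
      then have "x = proj n w" using v ker by (simp add: linear_add[OF lin])
      then show "x \<in> proj n ` seed n" using \<open>w \<in> seed n\<close> by blast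
    qed
  qed (auto simp: Xs_def)
  moreover have "subspace_of_dim (proj n ` seed n) K"
    using seed Xu_stable_cone_trivial ker by (intro subspace_of_dim_image[OF seed(1) lin]) blast
  ultimately show ?thesis by simp
qed

lemma Xs_complement: "direct_sum_decomposition (Xs n) (Xu n)"
  by (intro stable_complement Xs_dim Xs_cone)

text \<open>Surjectivity: the image of \<open>Xs m\<close> lies in \<open>Xs n\<close>, and it has dimension \<open>K\<close> and lies in the
  stable cone, so it is a complement of \<open>Xu n\<close>, as is \<open>Xs n\<close>. Nested complements of the same
  space agree.\<close>

lemma evol_bij_Xs:
  assumes "n \<le> m"
  shows "bij_betw (blinfun_apply (evol A n m)) (Xs m) (Xs n)"
proof (rule bij_betw_imageI)
  let ?E = "blinfun_apply (evol A n m)"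
  show "inj_on ?E (Xs m)"
  proof (rule inj_onI)
    fix x y assume xy: "x \<in> Xs m" "y \<in> Xs m" "?E x = ?E y"
    then have "x - y \<in> Xs m"
      using Xs_dim subspace_diff unfolding subspace_of_dim_def by blast
    then have "x - y = 0"
      using evol_stable_cone_eq_0[OF assms, of "x - y"] xy Xs_cone stable_cone_c3_subset_c4
      by (simp add: blinfun.diff_right subset_iff)
    then show "x = y" by simp
  qed
  have sub: "?E ` Xs m \<subseteq> Xs n"
    by (auto simp: Xs_def simp flip: proj_evol[OF assms])
  moreover have "Xs n \<subseteq> ?E ` Xs m"
  proof
    fix x assume x: "x \<in> Xs n"
    have ds: "direct_sum_decomposition (?E ` Xs m) (Xu n)"
      by (intro stable_complement evol_image_stable[OF assms Xs_dim Xs_cone])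
    then obtain y d where y: "y \<in> ?E ` Xs m" "d \<in> Xu n" "x = y + d"
      unfolding direct_sum_decomposition_def by metis
    have "subspace (Xs n)" "Xs n \<inter> Xu n = {0}"
      using Xs_complement by (auto simp: direct_sum_decomposition_def)
    moreover have "y \<in> Xs n" using y(1) sub by blast
    ultimately have "x - y \<in> Xs n" using x subspace_diff by blast
    then have "d \<in> Xs n \<inter> Xu n" using y by simp
    then have "d = 0" using \<open>Xs n \<inter> Xu n = {0}\<close> by simp
    then show "x \<in> ?E ` Xs m" using y by simp
  qed
  ultimately show "?E ` Xs m = Xs n" by blast
qed

section \<open>The dichotomy\<close>

lemma dichotomy: "exponential_dichotomy A a b Xs Xu"
proof -
  define Ps where "Ps n = Blinfun (proj n)" for n
  define Pu where "Pu n = id_blinfun - Ps n" for n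
  define C where "C = Max {c\<^sub>4 + 2, D\<^sub>s, D\<^sub>u}"
  have Ps: "blinfun_apply (Ps n) = proj n" for n
    by (simp add: Ps_def bounded_linear_Blinfun_apply proj_bounded_linear)
  have Pu: "blinfun_apply (Pu n) v = v - proj n v" for n v
    by (simp add: Pu_def Ps blinfun.diff_left)
  have C: "c\<^sub>4 + 2 \<le> C" "D\<^sub>s \<le> C" "D\<^sub>u \<le> C"
    by (auto simp: C_def)
  have proj: "associated_projections (Xs n) (Xu n) (Ps n) (Pu n)" for n
    unfolding associated_projections_def Ps Pu using diff_proj_mem_Xu by (auto simp: Xs_def)
  have bound: "norm (Ps n) + norm (Pu n) \<le> C" for n
  proof -
    have "norm (Ps n) \<le> (c\<^sub>4 + 1) / 2"
      using proj_bound c4 by (intro norm_blinfun_bound) (auto simp: Ps)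
    moreover have "norm (Pu n) \<le> 1 + norm (Ps n)"
      unfolding Pu_def using norm_triangle_ineq4[of id_blinfun "Ps n"]
        norm_blinfun_id_le[where 'a='a] by linarith
    ultimately show ?thesis using C(1) by simp
  qed
  have intertwine: "evol A n m o\<^sub>L Ps m = Ps n o\<^sub>L evol A n m"
    and intertwine': "evol A n m o\<^sub>L Pu m = Pu n o\<^sub>L evol A n m" if "n \<le> m" for n m
    using that by (auto intro!: blinfun_eqI simp: Ps Pu proj_evol blinfun.diff_right)
  have backward: "norm (inv_into (Xs m) (blinfun_apply (evol A n m)) v) \<le> C * a ^ (m - n) * norm v"
    if "n \<le> m" "v \<in> Xs n" for n m v
  proof -
    let ?u = "inv_into (Xs m) (blinfun_apply (evol A n m)) v"
    have v: "v \<in> blinfun_apply (evol A n m) ` Xs m"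
      using evol_bij_Xs[OF that(1)] that(2) by (simp add: bij_betw_def)
    have "?u \<in> Vs c\<^sub>3 m" using inv_into_into[OF v] Xs_cone by blast
    then have "norm ?u \<le> D\<^sub>s * a ^ (m - n) * norm v"
      using norm_le_evol[OF that(1)] f_inv_into_f[OF v] by metis
    also have "\<dots> \<le> C * a ^ (m - n) * norm v"
      using C a by (intro mult_right_mono) auto
    finally show ?thesis .
  qed
  have forward: "norm (blinfun_apply (evol A n m) v) \<le> C * b powi (int n - int m) * norm v"
    if "n \<le> m" "v \<in> Xu m" for n m v
  proof -
    have "int n - int m = - int (m - n)" using that by simp
    then have pw: "b powi (int n - int m) = (1 / b) ^ (m - n)"
      by (simp only: power_int_minus power_int_of_nat) (simp add: power_one_over inverse_eq_divide)
    have "D\<^sub>u * (1 / b) ^ (m - n) * norm v \<le> C * (1 / b) ^ (m - n) * norm v"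
      using C b by (intro mult_right_mono) auto
    then show ?thesis unfolding pw using evol_Xu_le_norm[OF that] by linarith
  qed
  show ?thesis unfolding exponential_dichotomy_def
    by (rule conjI[OF a conjI[OF ab]], rule exI[of _ Ps], rule exI[of _ Pu], rule exI[of _ C])
      (intro conjI allI impI ballI Xs_complement proj bound intertwine intertwine' evol_bij_Xs backward forward)
qed

end

theorem theorem2:
  fixes A :: "nat \<Rightarrow> 'a::banach \<Rightarrow>\<^sub>L 'a"
    and Iminus Iplus :: "nat \<Rightarrow> 'a \<Rightarrow> real"
    and c\<^sub>1 c\<^sub>2 c\<^sub>3 c\<^sub>4 a b :: real
    and K :: nat
    and \<alpha> :: "nat \<Rightarrow> nat \<Rightarrow> 'a \<Rightarrow>\<^sub>L real"
  assumes "\<And>n v. Iminus n v \<ge> 0" and "\<And>n v. Iplus n v \<ge> 0"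
    and "\<And>n. continuous_on UNIV (Iminus n)" and "\<And>n. continuous_on UNIV (Iplus n)"
    and "\<And>n. homogeneous (Iminus n)" and "\<And>n. homogeneous (Iplus n)"
    and "c\<^sub>1 > 0" and "c\<^sub>2 > 0" and "c\<^sub>3 > 0" and "c\<^sub>4 > 0" and "0 < a" and "a < b"
    and "\<And>n v. c\<^sub>1 * norm v \<le> Iminus n v + Iplus n v"
    and "\<And>n v. Iminus n v + Iplus n v \<le> 1 / c\<^sub>1 * norm v"
    and "\<And>n v. c\<^sub>2 * max_or_zero ((\<lambda>k. \<bar>blinfun_apply (\<alpha> k n) v\<bar>) ` {1..K}) \<le> Iminus n v"
    and "\<And>n v. Iminus n v \<le> 1 / c\<^sub>2 * max_or_zero ((\<lambda>k. \<bar>blinfun_apply (\<alpha> k n) v\<bar>) ` {1..K})"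
    and "\<And>n. \<exists>S. subspace_of_dim S K \<and> S \<subseteq> stable_cone Iminus Iplus c\<^sub>3 n"
    and "c\<^sub>4 > 3 * (c\<^sub>1 * c\<^sub>2) powi (-2) * (c\<^sub>3 + 1)"
    and "\<And>n v. n \<ge> 1 \<Longrightarrow> v \<in> stable_cone Iminus Iplus c\<^sub>4 n \<Longrightarrow>
           Iminus n v \<le> a * Iminus (n - 1) (blinfun_apply (A n) v)"
    and "\<And>n v. n \<ge> 1 \<Longrightarrow> blinfun_apply (A n) v \<in> unstable_cone Iminus Iplus c\<^sub>3 (n - 1) \<Longrightarrow>
           Iplus n v \<ge> b * Iplus (n - 1) (blinfun_apply (A n) v)"
  shows "\<exists>Xs Xu. exponential_dichotomy A a b Xs Xu \<and>
           (\<forall>n. Xs n \<subseteq> stable_cone Iminus Iplus c\<^sub>3 n \<and> subspace_of_dim (Xs n) K)"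
proof -
  interpret cone_system A Iminus Iplus c\<^sub>1 c\<^sub>2 c\<^sub>3 c\<^sub>4 a b K \<alpha>
    by (rule cone_system.intro) (fact assms)+
  show ?thesis using dichotomy Xs_cone Xs_dim by blast
qed

end
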